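(* Let $m\geq 2$ be an integer and let $A$ be a finite subset of $\bigcup_{k\geq 2}\{1,\ldots,m-1\}^k$. Let $\mathrm{G}(\mathscr{C}(m,A))$ be the graph with vertex set $\mathscr{C}(m,A)$ in which $(S,S')\in\mathscr{C}(m,A)\times\mathscr{C}(m,A)$ is an edge if and only if $S\cup\{\mathrm{F}(S)\}=S'$. Then $\mathrm{G}(\mathscr{C}(m,A))$ is a tree with root $\Delta(m)$. Moreover, for each $S\in\mathscr{C}(m,A)$, the set of children of $S$ is $$\big\{S\setminus\{x\}\mid x\in\mathrm{msg}(S),\ S\setminus\{x\}\in\mathscr{C}(m,A),\ x>\mathrm{F}(S)\big\}.$$
   Context: $\mathbb{N}$ is the set of non-negative integers. A numerical semigroup is a subset $S\subseteq\mathbb{N}$ closed under addition, with $0\in S$ and $\mathbb{N}\setminus S$ finite. The multiplicity $\mathrm{m}(S)$ is the least positive element of $S$. The Frobenius number $\mathrm{F}(S)$ is the greatest integer not belonging to $S$. $\mathrm{msg}(S)$ is the (unique, finite) minimal system of generators of $S$ as a submonoid of $(\mathbb{N},+)$. $\mathscr{S}_m$ is the set of numerical semigroups with multiplicity $m$. $\Delta(m)=\{0\}\cup\{n\in\mathbb{N}\mid n\ge m\}$. $x \bmod m$ denotes the remainder after division of $x$ by $m$. For an integer $m\ge 2$ and a finite set $A\subseteq\bigcup_{k\geq 2}\{1,\ldots,m-1\}^k$, $\mathscr{C}(m,A)$ is the set of all $S\in\mathscr{S}_m$ such that for every $k\ge 2$ and every $(s_1,\ldots,s_k)\in S^k$ with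 $(s_1\bmod m,\ldots,s_k\bmod m)\in A$ one has $s_1+\cdots+s_k-m\in S$. A graph $G$ is a pair $(V,E)$ with $V$ a non-empty set (vertices) and $E\subseteq\{(v,w)\in V\times V\mid v\neq w\}$ (edges). A path connecting $x$ and $y$ is a sequence of different edges $(v_0,v_1),(v_1,v_2),\ldots,(v_{n-1},v_n)$ with $v_0=x$ and $v_n=y$. $G$ is a (rooted) tree with root $r\in V$ if for any other vertex $x$ there exists a unique path connecting $x$ and $r$. If $(x,y)$ is an edge of the tree, then $x$ is called a child of $y$. *)

theory Defs
  imports Complex_Main "Graph_Theory.Pair_Digraph"
begin

subsection \<open>Numerical semigroups\<close>

definition add_submonoid :: "nat set \<Rightarrow> bool" where
  "add_submonoid M \<longleftrightarrow> 0 \<in> M \<and> (\<forall>x\<in>M. \<forall>y\<in>M. x + y \<in> M)"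

definition numerical_semigroup :: "nat set \<Rightarrow> bool" where
  "numerical_semigroup S \<longleftrightarrow> add_submonoid S \<and> finite (UNIV - S)"

definition multiplicity_ns :: "nat set \<Rightarrow> nat" where
  "multiplicity_ns S = (LEAST n. n \<in> S \<and> 0 < n)"

text \<open>Integer-valued, so that the Frobenius number of \<open>UNIV\<close> is \<open>-1\<close>.\<close>

definition frobenius :: "nat set \<Rightarrow> int" where
  "frobenius S = (GREATEST z. z \<notin> int ` S)"

definition generates :: "nat set \<Rightarrow> nat set \<Rightarrow> bool" where
  "generates B S \<longleftrightarrow> add_submonoid hull B = S"

definition msg :: "nat set \<Rightarrow> nat set" where
  "msg S = (THE B. generates B S \<and> (\<forall>C. C \<subset> B \<longrightarrow> \<not> generates C S))"

definition Delta :: "nat \<Rightarrow> nat set" where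
  "Delta m = {0} \<union> {n. m \<le> n}"

text \<open>
  Tuples are lists. The difference \<open>s\<^sub>1 + \<dots> + s\<^sub>k - m\<close> is taken in the integers, so that it is
  not truncated.
\<close>

definition semigroups_mod :: "nat \<Rightarrow> nat list set \<Rightarrow> nat set set" where
  "semigroups_mod m A = {S. numerical_semigroup S \<and> multiplicity_ns S = m \<and>
     (\<forall>ss. 2 \<le> length ss \<longrightarrow> set ss \<subseteq> S \<longrightarrow> map (\<lambda>s. s mod m) ss \<in> A \<longrightarrow>
        int (sum_list ss) - int m \<in> int ` S)}"


subsection \<open>Rooted trees\<close>

text \<open>
  Edges are ordered pairs, and a path is a sequence of pairwise different edges, which is a
  \<^const>\<open>pre_digraph.trail\<close> in the library (an \<^const>\<open>pre_digraph.apath\<close> has pairwise different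
  vertices instead). The library's \<open>tree\<close> is not used: it is unrooted and meant for
  symmetric digraphs.
\<close>

definition rooted_tree :: "'a pair_pre_digraph \<Rightarrow> 'a \<Rightarrow> bool" where
  "rooted_tree G r \<longleftrightarrow>
     pair_loopfree_digraph G \<and> pverts G \<noteq> {} \<and> r \<in> pverts G \<and>
     (\<forall>x\<in>pverts G. x \<noteq> r \<longrightarrow> (\<exists>!p. pre_digraph.trail (with_proj G) x p r))"

definition children :: "'a pair_pre_digraph \<Rightarrow> 'a \<Rightarrow> 'a set" where
  "children G y = {x. (x, y) \<in> parcs G}"

definition frobenius_graph :: "nat set set \<Rightarrow> nat set pair_pre_digraph" where
  "frobenius_graph C = \<lparr> pverts = C,
     parcs = {(S, S') \<in> C \<times> C. int ` S \<union> {frobenius S} = int ` S'} \<rparr>"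

end

(*
  For S in C(m,A) with S \<noteq> Delta(m) one has F(S) > m, and S \<union> {F(S)} is again in C(m,A): a tuple
  with residues in A consists of at least two numbers, all greater than m, so that as soon as one
  of its entries is F(S), its sum minus m exceeds F(S). Hence every vertex except Delta(m) has
  exactly one outgoing edge, and Delta(m) has none. The number of gaps drops by one along each
  edge, so following the edges is the only way to go to the root. The children of S arise by
  removing some x with S - {x} closed under addition, which says that x is in msg(S).
*)
theory Submission
  imports Defs
begin

section \<open>Trees from a strictly decreasing partial map\<close>

text \<open>Since each vertex has at most one outgoing arc, a trail is forced arc by arc. Since
  \<open>f\<close> takes natural values and drops along arcs, the trail must stop, and only
  \<open>r\<close> lacks an outgoing arc.\<close>

lemma rooted_treeI:
  fixes f :: "'a \<Rightarrow> nat"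
  assumes arcs: "parcs G \<subseteq> pverts G \<times> pverts G"
    and r: "r \<in> pverts G"
    and sink: "\<And>y. (r, y) \<notin> parcs G"
    and functional: "\<And>x y z. (x, y) \<in> parcs G \<Longrightarrow> (x, z) \<in> parcs G \<Longrightarrow> y = z"
    and total: "\<And>x. x \<in> pverts G \<Longrightarrow> x \<noteq> r \<Longrightarrow> \<exists>y. (x, y) \<in> parcs G"
    and decreasing: "\<And>x y. (x, y) \<in> parcs G \<Longrightarrow> f y < f x"
  shows "rooted_tree G r"
proof -
  interpret pair_loopfree_digraph G
    using arcs decreasing by unfold_locales fastforce+
  \<comment> \<open>A trail needs pairwise different arcs, so an arc put in front must not occur
    later. This bound on the tails of the arcs of a walk will show that.\<close>
  have tail_le: "f (fst e) \<le> f y" if "awalk y p v" "e \<in> set p" for y p v e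
    using that
  proof (induction p arbitrary: y)
    case (Cons a p)
    have "f (snd a) < f (fst a)" "y = fst a" "awalk (snd a) p v"
      using Cons.prems(1) decreasing[of "fst a" "snd a"] by (auto simp: awalk_Cons_iff)
    then show ?case
      using Cons.IH[of "snd a"] Cons.prems(2) by force
  qed simp
  \<comment> \<open>The case \<open>x = r\<close> is included, with the empty trail, so that the
    induction can end at the root.\<close>
  have "\<exists>!p. trail x p r" if "x \<in> pverts G" for x
    using that
  proof (induction "f x" arbitrary: x rule: less_induct)
    case less
    show ?case
    proof (cases "x = r")
      case True
      have "trail r p r \<longleftrightarrow> p = []" for p
        using r sink by (cases p) (auto simp: trail_Nil_iff trail_Cons_iff)
      then show ?thesis
        unfolding True by simp
    next
      case False
      then obtain y where y: "(x, y) \<in> parcs G"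
        using total less.prems by blast
      then obtain p where p: "trail y p r" and p_unique: "\<And>q. trail y q r \<Longrightarrow> q = p"
        using less.hyps[of y] decreasing arcs by blast
      \<comment> \<open>Otherwise \<open>tail_le\<close> gives \<open>f x \<le> f y\<close>, against
        the decrease along \<open>(x, y)\<close>.\<close>
      have "(x, y) \<notin> set p"
        using tail_le[of y p r "(x, y)"] p decreasing[OF y] by (auto simp: trail_def)
      then have "trail x ((x, y) # p) r"
        using y p by (simp add: trail_Cons_iff)
      moreover have "q = (x, y) # p" if q: "trail x q r" for q
      proof (cases q)
        case Nil
        then show ?thesis
          using q False by (simp add: trail_Nil_iff)
      next
        case (Cons e es)
        then have "e \<in> parcs G" "x = fst e" "trail (snd e) es r"
          using q by (auto simp: trail_Cons_iff)
        then show ?thesis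
          using Cons functional[OF y, of "snd e"] p_unique by (cases e) auto
      qed
      ultimately show ?thesis
        by blast
    qed
  qed
  then show ?thesis
    unfolding rooted_tree_def using r pair_loopfree_digraph_axioms by blast
qed

section \<open>Minimal generators as irreducible elements\<close>

lemma add_submonoid_hull: "add_submonoid (add_submonoid hull B)"
  by (rule hull_in) (auto simp: add_submonoid_def)

text \<open>The atoms of the monoid, an explicit description that will replace the
  \<open>THE\<close> in \<open>msg\<close>.\<close>

definition irreducibles :: "nat set \<Rightarrow> nat set" where
  "irreducibles S = {x \<in> S - {0}. \<forall>y \<in> S - {0}. \<forall>z \<in> S - {0}. x \<noteq> y + z}"

text \<open>Removing \<open>x\<close> can break closure only through a sum equal to
  \<open>x\<close>. If both summands are nonzero, they differ from \<open>x\<close> and so survive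
  the removal; a zero summand would make the other one \<open>x\<close> itself.\<close>

lemma mem_irreducibles_iff:
  assumes "add_submonoid S" "x \<in> S"
  shows "x \<in> irreducibles S \<longleftrightarrow> add_submonoid (S - {x})"
proof
  assume "x \<in> irreducibles S"
  then have "0 \<noteq> x" and ne: "\<And>y z. y \<in> S \<Longrightarrow> z \<in> S \<Longrightarrow> y \<noteq> 0 \<Longrightarrow> z \<noteq> 0 \<Longrightarrow> y + z \<noteq> x"
    unfolding irreducibles_def by auto
  have "y + z \<noteq> x" if "y \<in> S - {x}" "z \<in> S - {x}" for y z
    using ne[of y z] that by (cases "y = 0"; cases "z = 0") auto
  then show "add_submonoid (S - {x})"
    using \<open>0 \<noteq> x\<close> assms unfolding add_submonoid_def by blast
next
  assume sub: "add_submonoid (S - {x})"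
  then have "x \<noteq> 0"
    unfolding add_submonoid_def by auto
  moreover have "x \<noteq> y + z" if "y \<in> S - {0}" "z \<in> S - {0}" for y z
  proof
    assume "x = y + z"
    then have "y \<in> S - {x}" "z \<in> S - {x}"
      using that by auto
    then show False
      using sub \<open>x = y + z\<close> unfolding add_submonoid_def by blast
  qed
  ultimately show "x \<in> irreducibles S"
    using assms(2) unfolding irreducibles_def by blast
qed

text \<open>Strong induction: a nonzero element that is not irreducible splits into two nonzero,
  hence smaller, elements.\<close>

lemma generates_irreducibles:
  assumes "add_submonoid S"
  shows "generates (irreducibles S) S"
  unfolding generates_def
proof
  show "add_submonoid hull irreducibles S \<subseteq> S"
    using assms by (intro hull_minimal) (auto simp: irreducibles_def)
  have "x \<in> add_submonoid hull irreducibles S" if "x \<in> S" for x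
    using that
  proof (induction x rule: less_induct)
    case (less x)
    consider "x = 0" | "x \<in> irreducibles S"
      | y z where "y \<in> S - {0}" "z \<in> S - {0}" "x = y + z"
      using less.prems unfolding irreducibles_def by blast
    then show ?case
    proof cases
      case 1
      then show ?thesis
        using add_submonoid_hull unfolding add_submonoid_def by blast
    next
      case 2
      then show ?thesis
        by (rule hull_inc)
    next
      case 3
      then have "y \<in> add_submonoid hull irreducibles S" "z \<in> add_submonoid hull irreducibles S"
        using less.IH by auto
      then show ?thesis
        using add_submonoid_hull[of "irreducibles S"] 3 unfolding add_submonoid_def by blast
    qed
  qed
  then show "S \<subseteq> add_submonoid hull irreducibles S"
    by blast
qed

text \<open>If \<open>B\<close> missed an irreducible \<open>x\<close>, the submonoid
  \<open>S - {x}\<close> would contain \<open>B\<close> and therefore its hull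
  \<open>S\<close>.\<close>

lemma irreducibles_subset_generators:
  assumes "generates B S"
  shows "irreducibles S \<subseteq> B"
proof (rule subsetI, rule ccontr)
  fix x assume x: "x \<in> irreducibles S" "x \<notin> B"
  have S: "add_submonoid hull B = S"
    using assms unfolding generates_def .
  then have "add_submonoid S" "B \<subseteq> S"
    using add_submonoid_hull[of B] hull_subset[of B add_submonoid] by auto
  moreover have "x \<in> S"
    using x unfolding irreducibles_def by blast
  ultimately have "add_submonoid (S - {x})" "B \<subseteq> S - {x}"
    using x mem_irreducibles_iff by auto
  then have "S \<subseteq> S - {x}"
    using hull_minimal[of B "S - {x}" add_submonoid] S by simp
  then show False
    using \<open>x \<in> S\<close> by blast
qed

text \<open>A generating set contained in every other one is the only minimal one.\<close>

lemma msg_eq_irreducibles: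
  assumes "add_submonoid S"
  shows "msg S = irreducibles S"
  unfolding msg_def
proof (rule the_equality)
  show "generates (irreducibles S) S \<and> (\<forall>C. C \<subset> irreducibles S \<longrightarrow> \<not> generates C S)"
    using generates_irreducibles[OF assms] irreducibles_subset_generators by blast
  show "B = irreducibles S" if "generates B S \<and> (\<forall>C. C \<subset> B \<longrightarrow> \<not> generates C S)" for B
    using that generates_irreducibles[OF assms] irreducibles_subset_generators by blast
qed

section \<open>Frobenius number and multiplicity\<close>

lemma frobenius_eqI:
  assumes "f \<notin> S" "\<And>n. f < n \<Longrightarrow> n \<in> S"
  shows "frobenius S = int f"
  unfolding frobenius_def
proof (rule Greatest_equality)
  show "int f \<notin> int ` S"
    using assms(1) by auto
  show "z \<le> int f" if "z \<notin> int ` S" for z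
  proof (rule ccontr)
    assume "\<not> z \<le> int f"
    \<comment> \<open>Here \<open>z\<close> exceeds a natural number, so \<open>nat\<close> loses
      nothing.\<close>
    then have "nat z \<in> S" "z = int (nat z)"
      using assms(2)[of "nat z"] by auto
    then show False
      using that by (metis imageI)
  qed
qed

text \<open>As \<open>S\<close> has a gap, the value -1 is excluded and the Frobenius number is the
  largest of finitely many gaps.\<close>

lemma frobeniusE:
  assumes "numerical_semigroup S" "S \<noteq> UNIV"
  obtains f where "frobenius S = int f" "f \<notin> S" "\<And>n. f < n \<Longrightarrow> n \<in> S"
proof -
  define f where "f = Max (UNIV - S)"
  have fin: "finite (UNIV - S)" and ne: "UNIV - S \<noteq> {}"
    using assms unfolding numerical_semigroup_def by auto
  then have "f \<notin> S"
    unfolding f_def using Max_in by blast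
  moreover have "n \<in> S" if "f < n" for n
    using that Max_ge[OF fin, of n] unfolding f_def by force
  ultimately show ?thesis
    using that frobenius_eqI by blast
qed

lemma numerical_semigroup_pos:
  assumes "numerical_semigroup S"
  shows "\<exists>n. n \<in> S \<and> 0 < n"
proof (rule ccontr)
  assume "\<nexists>n. n \<in> S \<and> 0 < n"
  then have "{0<..} \<subseteq> UNIV - S"
    by auto
  then show False
    using assms infinite_Ioi[of "0::nat"] finite_subset unfolding numerical_semigroup_def by blast
qed

lemma multiplicity_ns_eq_iff:
  assumes "numerical_semigroup S"
  shows "multiplicity_ns S = m \<longleftrightarrow> m \<in> S \<and> 0 < m \<and> (\<forall>n \<in> S. 0 < n \<longrightarrow> m \<le> n)"
proof
  assume m: "multiplicity_ns S = m"
  have "m \<in> S \<and> 0 < m"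
    using LeastI_ex[OF numerical_semigroup_pos[OF assms]] m unfolding multiplicity_ns_def by simp
  moreover have "m \<le> n" if "n \<in> S" "0 < n" for n
    using Least_le[of "\<lambda>n. n \<in> S \<and> 0 < n" n] that m unfolding multiplicity_ns_def by simp
  ultimately show "m \<in> S \<and> 0 < m \<and> (\<forall>n \<in> S. 0 < n \<longrightarrow> m \<le> n)"
    by blast
next
  assume "m \<in> S \<and> 0 < m \<and> (\<forall>n \<in> S. 0 < n \<longrightarrow> m \<le> n)"
  then show "multiplicity_ns S = m"
    unfolding multiplicity_ns_def by (intro Least_equality) auto
qed

section \<open>Membership in C(m,A)\<close>

lemma mem_semigroups_mod_iff:
  "S \<in> semigroups_mod m A \<longleftrightarrow>
     numerical_semigroup S \<and> m \<in> S \<and> 0 < m \<and> (\<forall>n \<in> S. 0 < n \<longrightarrow> m \<le> n) \<and>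
     (\<forall>ss. 2 \<le> length ss \<longrightarrow> set ss \<subseteq> S \<longrightarrow> map (\<lambda>s. s mod m) ss \<in> A \<longrightarrow>
        int (sum_list ss) - int m \<in> int ` S)"
  \<comment> \<open>The multiplicity can be rewritten only for numerical semigroups;
    \<open>conj_cong\<close> supplies that conjunct as a premise.\<close>
  by (simp add: semigroups_mod_def multiplicity_ns_eq_iff cong: conj_cong)

text \<open>The least positive element is \<open>m \<ge> 2\<close>, so 1 is a gap.\<close>

lemma semigroups_mod_frobeniusE:
  assumes "m \<ge> 2" "S \<in> semigroups_mod m A"
  obtains f where "frobenius S = int f" "f \<notin> S" "\<And>n. f < n \<Longrightarrow> n \<in> S"
proof -
  have "1 \<notin> S"
    using assms unfolding mem_semigroups_mod_iff by force
  then have "S \<noteq> UNIV"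
    by blast
  moreover have "numerical_semigroup S"
    using assms(2) unfolding semigroups_mod_def by simp
  ultimately show ?thesis
    using frobeniusE that by blast
qed

text \<open>Besides one occurrence of \<open>f\<close> the list has a further entry, which
  contributes at least \<open>b\<close>.\<close>

lemma sum_list_ge_add_of_mem:
  fixes ss :: "nat list"
  assumes "2 \<le> length ss" "f \<in> set ss" "\<And>s. s \<in> set ss \<Longrightarrow> b \<le> s"
  shows "f + b \<le> sum_list ss"
proof -
  obtain us vs where ss: "ss = us @ f # vs"
    using assms(2) by (auto simp: in_set_conv_decomp)
  obtain y where y: "y \<in> set (us @ vs)"
    using assms(1) ss by (cases us; cases vs) auto
  then have "b \<le> y" "y \<le> sum_list (us @ vs)"
    using assms(3) ss member_le_sum_list[of y "us @ vs"] by auto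
  then show ?thesis
    using ss by simp
qed

text \<open>Nonzero residues exclude the entry 0, so all entries are at least \<open>m\<close>; the
  sum is then at least \<open>2 * m\<close> and stays in \<open>Delta m\<close> after subtracting
  \<open>m\<close>.\<close>

lemma Delta_mem_semigroups_mod:
  assumes "m \<ge> 2" "A \<subseteq> {w. length w \<ge> 2 \<and> set w \<subseteq> {1..m-1}}"
  shows "Delta m \<in> semigroups_mod m A"
  unfolding mem_semigroups_mod_iff
proof (intro conjI ballI allI impI)
  have "UNIV - Delta m \<subseteq> {..<m}"
    unfolding Delta_def by auto
  then show "numerical_semigroup (Delta m)"
    unfolding numerical_semigroup_def add_submonoid_def
    using finite_subset[of _ "{..<m}"] by (auto simp: Delta_def)
  fix ss :: "nat list"
  assume len: "2 \<le> length ss" and sub: "set ss \<subseteq> Delta m" and A: "map (\<lambda>s. s mod m) ss \<in> A"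
  have ge: "m \<le> s" if "s \<in> set ss" for s
  proof -
    have "1 \<le> s mod m"
      using assms(2) A that by fastforce
    then show ?thesis
      using sub that by (cases "s = 0") (auto simp: Delta_def)
  qed
  obtain s where s: "s \<in> set ss"
    using len by (cases ss) auto
  then have "s + m \<le> sum_list ss" "m \<le> s"
    using sum_list_ge_add_of_mem[OF len s ge] ge by auto
  then show "int (sum_list ss) - int m \<in> int ` Delta m"
    by (intro image_eqI[of _ _ "sum_list ss - m"]) (auto simp: Delta_def)
qed (use assms in \<open>auto simp: Delta_def\<close>)

lemma insert_frobenius_mem_semigroups_mod:
  assumes "m \<ge> 2" "A \<subseteq> {w. length w \<ge> 2 \<and> set w \<subseteq> {1..m-1}}"
    and S: "S \<in> semigroups_mod m A"
    and f: "f \<notin> S" "\<And>n. f < n \<Longrightarrow> n \<in> S" and "S \<noteq> Delta m"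
  shows "insert f S \<in> semigroups_mod m A"
proof -
  have sg: "0 \<in> S" "\<And>x y. x \<in> S \<Longrightarrow> y \<in> S \<Longrightarrow> x + y \<in> S" "finite (UNIV - S)"
    and m: "m \<in> S" "0 < m" "\<And>n. n \<in> S \<Longrightarrow> 0 < n \<Longrightarrow> m \<le> n"
    and closed: "\<And>ss. 2 \<le> length ss \<Longrightarrow> set ss \<subseteq> S \<Longrightarrow> map (\<lambda>s. s mod m) ss \<in> A \<Longrightarrow>
        int (sum_list ss) - int m \<in> int ` S"
    using S unfolding mem_semigroups_mod_iff numerical_semigroup_def add_submonoid_def by auto
  \<comment> \<open>This keeps the multiplicity at \<open>m\<close> after adding \<open>f\<close>. A
    gap \<open>f\<close> below \<open>m\<close> with no gap above it would force
    \<open>S = Delta m\<close>.\<close>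
  have "m < f"
  proof (rule ccontr)
    assume "\<not> m < f"
    then have "f < m"
      using f(1) m(1) by (cases f m rule: linorder_cases) auto
    then have "n \<in> S" if "m \<le> n" for n
      using f(2) that by auto
    then have "S = Delta m"
      using sg(1) m(3) unfolding Delta_def by force
    then show False
      using \<open>S \<noteq> Delta m\<close> by simp
  qed
  have add_f: "f + y \<in> insert f S" for y
    using f(2)[of "f + y"] by (cases "y = 0") auto
  have "numerical_semigroup (insert f S)"
    unfolding numerical_semigroup_def add_submonoid_def
  proof (intro conjI ballI)
    show "x + y \<in> insert f S" if "x \<in> insert f S" "y \<in> insert f S" for x y
      using that sg(2) add_f[of x] add_f[of y] by (auto simp: add.commute)
    show "finite (UNIV - insert f S)"
      using sg(3) by (rule rev_finite_subset) auto
  qed (use sg in auto)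
  moreover have "int (sum_list ss) - int m \<in> int ` insert f S"
    if len: "2 \<le> length ss" and sub: "set ss \<subseteq> insert f S" and A: "map (\<lambda>s. s mod m) ss \<in> A"
    for ss
  proof (cases "f \<in> set ss")
    case True
    \<comment> \<open>The nonzero residue excludes both 0 and \<open>m\<close>. The bound
      \<open>Suc m\<close> in place of \<open>m\<close> makes the sum minus \<open>m\<close> exceed
      \<open>f\<close> strictly, hence lie in \<open>S\<close>.\<close>
    have "Suc m \<le> s" if "s \<in> set ss" for s
    proof -
      have "1 \<le> s mod m"
        using assms(2) A that by fastforce
      then have "0 < s" "s \<noteq> m"
        by (auto intro: Nat.gr0I)
      then show ?thesis
        using sub that m(3)[of s] \<open>m < f\<close> by force
    qed
    then have "f + Suc m \<le> sum_list ss"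
      using sum_list_ge_add_of_mem[OF len True] by blast
    then show ?thesis
      using f(2)[of "sum_list ss - m"]
      by (intro image_eqI[of _ _ "sum_list ss - m"]) auto
  next
    case False
    then show ?thesis
      using closed[OF len _ A] sub by blast
  qed
  ultimately show ?thesis
    unfolding mem_semigroups_mod_iff using m \<open>m < f\<close> by auto
qed

section \<open>The graph and its children\<close>

text \<open>Injectivity of \<open>int\<close> carries the integer equation defining the arcs back to
  sets of naturals.\<close>

lemma frobenius_arc_iff:
  assumes "frobenius S = int f"
  shows "(S, S') \<in> parcs (frobenius_graph C) \<longleftrightarrow> S \<in> C \<and> S' \<in> C \<and> S' = insert f S"
proof -
  have "int ` S \<union> {frobenius S} = int ` insert f S"
    using assms by auto
  then show ?thesis
    unfolding frobenius_graph_def by (auto simp: inj_image_eq_iff simp del: image_insert)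
qed

theorem theorem2p7:
  fixes m :: nat and A :: "nat list set"
  assumes "m \<ge> 2"
    and "finite A"
    and "A \<subseteq> {w. length w \<ge> 2 \<and> set w \<subseteq> {1..m-1}}"
  shows "rooted_tree (frobenius_graph (semigroups_mod m A)) (Delta m) \<and>
    (\<forall>S \<in> semigroups_mod m A.
       children (frobenius_graph (semigroups_mod m A)) S =
         {S - {x} | x. x \<in> msg S \<and> S - {x} \<in> semigroups_mod m A \<and> int x > frobenius S})"
proof (intro conjI ballI)
  let ?C = "semigroups_mod m A"
  let ?G = "frobenius_graph ?C"
  have verts: "pverts ?G = ?C" and arcs: "parcs ?G \<subseteq> ?C \<times> ?C"
    unfolding frobenius_graph_def by auto
  have arcE: thesis
    if "(S, S') \<in> parcs ?G"
      and "\<And>f. frobenius S = int f \<Longrightarrow> f \<notin> S \<Longrightarrow> (\<And>n. f < n \<Longrightarrow> n \<in> S) \<Longrightarrow>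
        S' = insert f S \<Longrightarrow> thesis" for S S' thesis
    using that arcs semigroups_mod_frobeniusE[OF assms(1), of S A] frobenius_arc_iff
    by (metis SigmaD1 subsetD)
  show "rooted_tree ?G (Delta m)"
  proof (rule rooted_treeI[where f = "\<lambda>S. card (UNIV - S)"])
    show "parcs ?G \<subseteq> pverts ?G \<times> pverts ?G"
      using arcs verts by simp
    show "Delta m \<in> pverts ?G"
      using Delta_mem_semigroups_mod[OF assms(1,3)] verts by simp
    show "(Delta m, S) \<notin> parcs ?G" for S
    proof
      assume arc: "(Delta m, S) \<in> parcs ?G"
      then obtain f where f: "f \<notin> Delta m" "S = insert f (Delta m)"
        by (rule arcE)
      have "S \<in> ?C"
        using arc arcs by blast
      \<comment> \<open>The added \<open>f\<close> lies outside \<open>Delta m\<close>, so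
        \<open>0 < f < m\<close>, which multiplicity \<open>m\<close> forbids.\<close>
      then have "\<forall>n \<in> S. 0 < n \<longrightarrow> m \<le> n"
        unfolding mem_semigroups_mod_iff by blast
      then show False
        using f unfolding Delta_def by auto
    qed
    show "S' = S''" if "(S, S') \<in> parcs ?G" "(S, S'') \<in> parcs ?G" for S S' S''
      using that unfolding frobenius_graph_def by (auto simp: inj_image_eq_iff[OF inj_of_nat])
    show "\<exists>S'. (S, S') \<in> parcs ?G" if "S \<in> pverts ?G" "S \<noteq> Delta m" for S
    proof -
      have S: "S \<in> ?C"
        using that verts by simp
      then obtain f where f: "frobenius S = int f" "f \<notin> S" "\<And>n. f < n \<Longrightarrow> n \<in> S"
        using semigroups_mod_frobeniusE[OF assms(1)] by blast
      then have "insert f S \<in> ?C"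
        using insert_frobenius_mem_semigroups_mod[OF assms(1,3) S] that by blast
      then show ?thesis
        using S frobenius_arc_iff[OF f(1)] by blast
    qed
    show "card (UNIV - S') < card (UNIV - S)" if arc: "(S, S') \<in> parcs ?G" for S S'
    proof -
      from arc obtain f where "f \<notin> S" "S' = insert f S"
        by (rule arcE)
      moreover have "S \<in> ?C"
        using arc arcs by blast
      \<comment> \<open>The strict inequality rests on this, since \<open>card\<close> is 0 on
        infinite sets.\<close>
      then have "finite (UNIV - S)"
        unfolding mem_semigroups_mod_iff numerical_semigroup_def by blast
      ultimately show ?thesis
        by (intro psubset_card_mono) auto
    qed
  qed
  fix S assume S: "S \<in> ?C"
  then have sub: "add_submonoid S"
    unfolding mem_semigroups_mod_iff numerical_semigroup_def by blast
  obtain f where f: "frobenius S = int f" "f \<notin> S" "\<And>n. f < n \<Longrightarrow> n \<in> S"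
    using semigroups_mod_frobeniusE[OF assms(1) S] by blast
  show "children ?G S =
      {S - {x} | x. x \<in> msg S \<and> S - {x} \<in> ?C \<and> int x > frobenius S}" (is "_ = ?R")
  proof (intro set_eqI iffI)
    fix T assume "T \<in> children ?G S"
    then have arc: "(T, S) \<in> parcs ?G"
      unfolding children_def by simp
    then obtain x where x: "x \<notin> T" "\<And>n. x < n \<Longrightarrow> n \<in> T" "S = insert x T"
      using arcE by blast
    then have T: "T = S - {x}" "x \<in> S"
      by auto
    have "T \<in> ?C"
      using arc arcs by blast
    then have "add_submonoid (S - {x})"
      using T(1) unfolding mem_semigroups_mod_iff numerical_semigroup_def by blast
    then have "x \<in> msg S"
      using mem_irreducibles_iff[OF sub T(2)] msg_eq_irreducibles[OF sub] by simp
    \<comment> \<open>All numbers from \<open>x\<close> on lie in \<open>S\<close>, whereas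
      \<open>f\<close> does not.\<close>
    moreover have "f < x"
      using x f(2) by (cases f x rule: linorder_cases) auto
    ultimately show "T \<in> ?R"
      using T(1) \<open>T \<in> ?C\<close> f(1) by auto
  next
    fix T assume "T \<in> ?R"
    then obtain x where x: "T = S - {x}" "x \<in> msg S" "T \<in> ?C" "f < x"
      using f(1) by auto
    then have "x \<in> S"
      unfolding msg_eq_irreducibles[OF sub] irreducibles_def by blast
    \<comment> \<open>Everything above \<open>x\<close> is above \<open>f\<close>, hence in
      \<open>S\<close>, and survives the removal of \<open>x\<close>.\<close>
    moreover have "frobenius T = int x"
      using x f(3) by (intro frobenius_eqI) auto
    ultimately show "T \<in> children ?G S"
      using frobenius_arc_iff[of T x S ?C] x S unfolding children_def by auto
  qed
qed

end
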